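(* Let $\mathcal{M}$ be a constrained Markov decision process with fixed initial state $s_0\in\mathcal{S}$ and total damage budget $\Delta$, let $\tilde{\mathcal{M}}$ be its augmented MDP, and let $k_*(s,a)$ be the minimal required budget. Then the set of feasible, stationary policies for the problem $$\text{(A)}\quad \max_{\tilde\pi\in\tilde\Pi_H}\ \mathbb{E}_{\tilde\pi,\tilde{\mathcal{M}}}\Big[\sum_{t=0}^\infty R_{t+1}\,\Big|\,(S_0,K_0)=(s_0,\Delta)\Big]\quad\text{s.t.}\quad P_{\tilde\pi}\big(\tilde D_{t+1}=0\big)=1\ \ \forall t\ge 0$$ is $$\tilde\Pi_S^F=\big\{\tilde\pi:\ \tilde\pi(a\mid s,k)=0\quad \forall a:\ k_*(s,a)>k\big\}$$ (the condition being imposed for all augmented states $(s,k)$).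
   Context: A constrained Markov decision process (CMDP) $\mathcal{M}=(\mathcal{S},\mathcal{A},p,r,d)$ has a finite state set $\mathcal{S}$, a finite action set $\mathcal{A}$, infinite horizon, and a transition kernel $p(s',r,d\mid s,a)$ giving the conditional law of the next state $S_{t+1}=s'$, the reward $R_{t+1}=r\in\mathbb{R}$ and the binary damage indicator $D_{t+1}=d\in\{0,1\}$ given $S_t=s$, $A_t=a$. The total damage budget $\Delta$ is a user-specified nonnegative integer. Standing assumptions: there is an absorbing termination state in which the system remains with no further reward, and this state is eventually reached under any policy. The budget is $K_0=\Delta$, $K_{t+1}=K_t-D_{t+1}$. The augmented MDP $\tilde{\mathcal{M}}$ has transition tuples $(\tilde S_t,A_t,\tilde S_{t+1},R_{t+1},\tilde D_{t+1})$ with $\tilde S_t=(S_t,K_t)$ and $\tilde D_{t+1}=\mathbf{1}\{K_t-D_{t+1}<0\}$; its states lie in $\mathcal{S}\times\{\Delta,\Delta-1,\dots,0\}$. $\tilde\Pi_H$ is the set of history-dependent policies of $\tilde{\mathcal{M}}$. In (A) the initial augmented state is fixed to be $(S_0,K_0)=(s_0,\Delta)$. A stationary policy $\tilde\pi$ of $\tilde{\mathcal{M}}$ chooses actions according to a distribution $\tilde\pi(\cdot\mid s,k)$ on $\mathcal{A}$ depending only on the current augmented state $(s,k)$. A policy is feasible for (A) if it satisfies the constraint of (A). Barrier function: for a stationary policy $\tilde\pi$, $$B_{\tilde\pi}(s,k,a)=\mathbb{E}_{\tilde\pi}\Big[\mathbb{I}\Big\{\sum_{\ell=t}^\infty D_{\ell+1}\le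 K_t\Big\}\,\Big|\,S_t=s,K_t=k,A_t=a\Big],$$ where $\mathbb{I}\{x\}=0$ if $x$ is true and $\mathbb{I}\{x\}=-\infty$ otherwise. So $B_{\tilde\pi}(s,k,a)=0$ if, starting from $(s,k,a)$ and following $\tilde\pi$, the total future damage is at most $k$ with probability one, and $B_{\tilde\pi}(s,k,a)=-\infty$ otherwise. The optimal barrier function is $B_*(s,k,a)=\max_{\tilde\pi}B_{\tilde\pi}(s,k,a)$. The minimal required budget of a pair $(s,a)$ is $$k_*(s,a)=\min_{0\le k\le\infty} k\quad\text{s.t. } B_*(s,k,a)=0.$$
   Formalization: The claimed equality fails if the condition is imposed at all augmented states (unreached ones may be unsafe); it is proved with the condition only at augmented states visited with positive probability from (s_0,Δ) under the policy, plus the inclusion of the literal set in the feasible set. *)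

theory Defs
  imports "HOL-Probability.Probability"
begin

text \<open>
  A transition kernel assigns to a state and an action the joint law of the next state, the reward
  and the damage indicator.  Rewards are arbitrary real random variables, hence a general
  measure.  Coordinate \<open>t\<close> of a trajectory is the step \<open>(A\<^sub>t, S\<^sub>t\<^sub>+\<^sub>1, R\<^sub>t\<^sub>+\<^sub>1, D\<^sub>t\<^sub>+\<^sub>1)\<close>; together with
  the initial augmented state \<open>x = (S\<^sub>0, K\<^sub>0)\<close> the steps determine the whole process.
\<close>

type_synonym ('s, 'a) kernel = "'s \<Rightarrow> 'a \<Rightarrow> ('s \<times> real \<times> bool) measure"
type_synonym ('s, 'a) step = "'a \<times> 's \<times> real \<times> bool"
type_synonym 's aug = "'s \<times> int"

definition outcome_space :: "('s \<times> real \<times> bool) measure" where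
  "outcome_space = count_space UNIV \<Otimes>\<^sub>M borel \<Otimes>\<^sub>M count_space UNIV"

definition step_space :: "('s, 'a) step measure" where
  "step_space = count_space UNIV \<Otimes>\<^sub>M outcome_space"

definition reward :: "(nat \<Rightarrow> ('s, 'a) step) \<Rightarrow> nat \<Rightarrow> real" where
  "reward \<omega> t = fst (snd (snd (\<omega> t)))"

definition damage :: "(nat \<Rightarrow> ('s, 'a) step) \<Rightarrow> nat \<Rightarrow> nat" where
  "damage \<omega> t = of_bool (snd (snd (snd (\<omega> t))))"

fun state :: "'s aug \<Rightarrow> (nat \<Rightarrow> ('s, 'a) step) \<Rightarrow> nat \<Rightarrow> 's" where
  "state x \<omega> 0 = fst x"
| "state x \<omega> (Suc t) = fst (snd (\<omega> t))"

fun budget :: "'s aug \<Rightarrow> (nat \<Rightarrow> ('s, 'a) step) \<Rightarrow> nat \<Rightarrow> int" where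
  "budget x \<omega> 0 = snd x"
| "budget x \<omega> (Suc t) = budget x \<omega> t - int (damage \<omega> t)"

text \<open>\<open>aug_damage x \<omega> t\<close> is the indicator of the augmented process at time \<open>t + 1\<close>.\<close>

definition aug_damage :: "'s aug \<Rightarrow> (nat \<Rightarrow> ('s, 'a) step) \<Rightarrow> nat \<Rightarrow> nat" where
  "aug_damage x \<omega> t = of_bool (budget x \<omega> t - int (damage \<omega> t) < 0)"

text \<open>
  A history-dependent policy chooses the law of \<open>A\<^sub>t\<close> from the initial augmented state, the time \<open>t\<close>
  and the first \<open>t\<close> steps; it is only relevant on \<open>space (PiM {0..<t} (\<lambda>_. step_space))\<close>, whose
  elements carry no information beyond these steps.
\<close>

type_synonym ('s, 'a) hist_policy = "'s aug \<Rightarrow> nat \<Rightarrow> (nat \<Rightarrow> ('s, 'a) step) \<Rightarrow> 'a pmf"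
type_synonym ('s, 'a) stat_policy = "'s \<Rightarrow> int \<Rightarrow> 'a pmf"

definition hist_policies :: "('s, 'a) hist_policy set" where
  "hist_policies = {\<pi>. \<forall>x t a. (\<lambda>\<omega>. pmf (\<pi> x t \<omega>) a)
     \<in> borel_measurable (PiM {0..<t} (\<lambda>_. step_space))}"

definition stationary :: "('s, 'a) stat_policy \<Rightarrow> ('s, 'a) hist_policy" where
  "stationary \<pi> x t \<omega> = \<pi> (state x \<omega> t) (budget x \<omega> t)"

text \<open>
  The law of the trajectory started in \<open>x\<close>, by the Ionescu-Tulcea theorem; its applicability for
  all policies in \<open>hist_policies\<close> is lemma \<open>Ionescu_Tulcea_step_kernel\<close> below.
\<close>

definition step_kernel ::
  "('s, 'a) kernel \<Rightarrow> ('s, 'a) hist_policy \<Rightarrow> 's aug \<Rightarrow> nat \<Rightarrow> (nat \<Rightarrow> ('s, 'a) step)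
    \<Rightarrow> ('s, 'a) step measure" where
  "step_kernel p \<pi> x t \<omega> =
     measure_pmf (\<pi> x t \<omega>) \<bind> (\<lambda>a. distr (p (state x \<omega> t) a) step_space (Pair a))"

definition traj :: "('s, 'a) kernel \<Rightarrow> ('s, 'a) hist_policy \<Rightarrow> 's aug \<Rightarrow>
    (nat \<Rightarrow> ('s, 'a) step) measure" where
  "traj p \<pi> x = projective_family.lim UNIV
     (Ionescu_Tulcea.CI (step_kernel p \<pi> x) (\<lambda>_. step_space)) (\<lambda>_. step_space)"

text \<open>
  The last assumption is the existence of an absorbing, reward-free termination state that is
  reached almost surely under every policy from every initial state.
\<close>

locale cmdp =
  fixes p :: "('s::finite, 'a::finite) kernel"
  assumes prob_space_kernel: "prob_space (p s a)"
    and sets_kernel: "sets (p s a) = sets outcome_space"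
    and absorbing_termination: "\<exists>z. (\<forall>a. AE (s', r, d) in p z a. s' = z \<and> r = 0) \<and>
      (\<forall>\<pi>\<in>hist_policies. \<forall>x. AE \<omega> in traj p \<pi> x. \<exists>t. state x \<omega> t = z)"

subsection \<open>The constrained problem on the augmented process\<close>

record 'p constrained_problem =
  policies :: "'p set"
  objective :: "'p \<Rightarrow> real"
  constraint :: "'p \<Rightarrow> bool"

definition feasible :: "'p constrained_problem \<Rightarrow> 'p set" where
  "feasible P = {\<pi> \<in> policies P. constraint P \<pi>}"

definition problem_A :: "('s, 'a) kernel \<Rightarrow> 's \<Rightarrow> nat \<Rightarrow> ('s, 'a) hist_policy constrained_problem" where
  "problem_A p s0 \<Delta> = (let x = (s0, int \<Delta>) in
    \<lparr> policies = hist_policies,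
      objective = (\<lambda>\<pi>. \<integral>\<omega>. (\<Sum>t. reward \<omega> t) \<partial>traj p \<pi> x),
      constraint = (\<lambda>\<pi>. \<forall>t. measure (traj p \<pi> x)
        {\<omega> \<in> space (traj p \<pi> x). aug_damage x \<omega> t = 0} = 1) \<rparr>)"

definition feasible_stationary :: "('s, 'a) kernel \<Rightarrow> 's \<Rightarrow> nat \<Rightarrow> ('s, 'a) stat_policy set" where
  "feasible_stationary p s0 \<Delta> = {\<pi>. stationary \<pi> \<in> feasible (problem_A p s0 \<Delta>)}"

subsection \<open>Barrier function and minimal required budget\<close>

definition barrier_ind :: "bool \<Rightarrow> ereal" where
  "barrier_ind b = (if b then 0 else - \<infinity>)"

definition total_damage :: "(nat \<Rightarrow> ('s, 'a) step) \<Rightarrow> ennreal" where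
  "total_damage \<omega> = (\<Sum>t. of_nat (damage \<omega> t))"

definition first_action :: "'a \<Rightarrow> ('s, 'a) hist_policy \<Rightarrow> ('s, 'a) hist_policy" where
  "first_action a \<pi> x t \<omega> = (if t = 0 then return_pmf a else \<pi> x t \<omega>)"

text \<open>
  The policy is stationary and the kernel is time-homogeneous, so conditioning on
  \<open>(S\<^sub>t, K\<^sub>t, A\<^sub>t) = (s, k, a)\<close> is rendered by starting in \<open>(s, k)\<close> with first action \<open>a\<close>.  The integrand
  is nonpositive and extended-valued; its expectation is minus the nonnegative integral of its
  negation.
\<close>

definition barrier :: "('s, 'a) kernel \<Rightarrow> ('s, 'a) stat_policy \<Rightarrow> 's \<Rightarrow> nat \<Rightarrow> 'a \<Rightarrow> ereal" where
  "barrier p \<pi> s k a = - enn2ereal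
     (\<integral>\<^sup>+\<omega>. e2ennreal (- barrier_ind (total_damage \<omega> \<le> of_nat k))
        \<partial>traj p (first_action a (stationary \<pi>)) (s, int k))"

text \<open>The barrier only takes the values \<open>0\<close> and \<open>-\<infinity>\<close>, so the supremum is attained.\<close>

definition opt_barrier :: "('s, 'a) kernel \<Rightarrow> 's \<Rightarrow> nat \<Rightarrow> 'a \<Rightarrow> ereal" where
  "opt_barrier p s k a = (SUP \<pi>. barrier p \<pi> s k a)"

text \<open>
  The budget \<open>\<infinity>\<close> is never exceeded, so \<open>k = \<infinity>\<close> always satisfies the side condition; it is the
  minimum exactly when no finite budget suffices.
\<close>

definition min_budget :: "('s, 'a) kernel \<Rightarrow> 's \<Rightarrow> 'a \<Rightarrow> enat" where
  "min_budget p s a = Inf {k. \<forall>n. k = enat n \<longrightarrow> opt_barrier p s n a = 0}"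

subsection \<open>Policies that respect the minimal required budget\<close>

definition aug_states :: "nat \<Rightarrow> ('s \<times> nat) set" where
  "aug_states \<Delta> = UNIV \<times> {0..\<Delta>}"

text \<open>
  The augmented states that the process started in \<open>(s0, \<Delta>)\<close> visits with positive probability
  under the given stationary policy.  Feasibility does not constrain the policy elsewhere: in an
  unvisited state \<open>(s, k)\<close> it may even be that \<open>min_budget p s a > k\<close> for all \<open>a\<close>, in which case
  no policy at all satisfies \<open>respects_budget p (aug_states \<Delta>)\<close>.
\<close>

definition visited :: "('s, 'a) kernel \<Rightarrow> 's \<Rightarrow> nat \<Rightarrow> ('s, 'a) stat_policy \<Rightarrow> ('s \<times> nat) set" where
  "visited p s0 \<Delta> \<pi> = {(s, k) \<in> aug_states \<Delta>.
     let x = (s0, int \<Delta>); M = traj p (stationary \<pi>) x in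
       \<exists>t. measure M {\<omega> \<in> space M. state x \<omega> t = s \<and> budget x \<omega> t = int k} > 0}"

definition respects_budget ::
    "('s, 'a) kernel \<Rightarrow> ('s \<times> nat) set \<Rightarrow> ('s, 'a) stat_policy \<Rightarrow> bool" where
  "respects_budget p X \<pi> \<longleftrightarrow>
     (\<forall>(s, k) \<in> X. \<forall>a. min_budget p s a > enat k \<longrightarrow> pmf (\<pi> s (int k)) a = 0)"

subsection \<open>Well-definedness of the trajectory law\<close>

lemma measurable_outcome:
  "fst \<in> measurable outcome_space (count_space UNIV)"
  "snd \<in> measurable outcome_space (borel \<Otimes>\<^sub>M count_space UNIV)"
  unfolding outcome_space_def by (rule measurable_fst measurable_snd)+

lemma measurable_step:
  "fst \<in> measurable step_space (count_space UNIV)"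
  "snd \<in> measurable step_space outcome_space"
  unfolding step_space_def by (rule measurable_fst measurable_snd)+

lemma measurable_damage:
  assumes "i \<in> I"
  shows "(\<lambda>\<omega>. damage \<omega> i) \<in> measurable (PiM I (\<lambda>_. step_space)) (count_space UNIV)"
  unfolding damage_def
  by (rule measurable_compose[OF measurable_component_singleton[OF assms]],
      rule measurable_compose[OF measurable_step(2)],
      rule measurable_compose[OF measurable_outcome(2)],
      rule measurable_compose[OF measurable_snd]) simp

lemma measurable_state:
  assumes "{0..<t} \<subseteq> I"
  shows "(\<lambda>\<omega>. state x \<omega> t) \<in> measurable (PiM I (\<lambda>_. step_space)) (count_space UNIV)"
proof (cases t)
  case (Suc n)
  then have "n \<in> I" using assms by auto
  show ?thesis unfolding Suc state.simps
    by (rule measurable_compose[OF measurable_component_singleton[OF \<open>n \<in> I\<close>]],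
        rule measurable_compose[OF measurable_step(2)], rule measurable_outcome(1))
qed simp

lemma measurable_budget:
  assumes "{0..<t} \<subseteq> I"
  shows "(\<lambda>\<omega>. budget x \<omega> t) \<in> measurable (PiM I (\<lambda>_. step_space)) (count_space UNIV)"
  using assms
proof (induction t)
  case (Suc t)
  then have t: "t \<in> I" and "{0..<t} \<subseteq> I" by auto
  note 1 = Suc.IH[OF this(2)] and 2 = measurable_damage[OF t]
  have "(\<lambda>(k, d). k - int d) \<in>
      measurable (count_space UNIV \<Otimes>\<^sub>M count_space UNIV) (count_space UNIV)"
    by (simp add: pair_measure_countable)
  from measurable_compose[OF measurable_Pair[OF 1 2] this] show ?case by simp
qed simp

lemma stationary_in_hist_policies: "stationary \<pi> \<in> hist_policies"
  for \<pi> :: "('s::finite, 'a) stat_policy"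
  unfolding hist_policies_def stationary_def mem_Collect_eq
proof (intro allI)
  fix x :: "'s aug" and t :: nat and a :: 'a
  let ?M = "PiM {0..<t} (\<lambda>_. step_space :: ('s, 'a) step measure)"
  have 1: "(\<lambda>\<omega>. (state x \<omega> t, budget x \<omega> t)) \<in> measurable ?M (count_space UNIV \<Otimes>\<^sub>M count_space UNIV)"
    by (intro measurable_Pair measurable_state measurable_budget) auto
  have 2: "(\<lambda>(s, k). pmf (\<pi> s k) a) \<in> borel_measurable (count_space UNIV \<Otimes>\<^sub>M count_space UNIV)"
    by (simp add: pair_measure_countable)
  show "(\<lambda>\<omega>. pmf (\<pi> (state x \<omega> t) (budget x \<omega> t)) a) \<in> borel_measurable ?M"
    using measurable_compose[OF 1 2] by simp
qed

lemma first_action_in_hist_policies: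
  "\<pi> \<in> hist_policies \<Longrightarrow> first_action a \<pi> \<in> hist_policies"
  unfolding hist_policies_def first_action_def mem_Collect_eq
proof (intro allI)
  fix x t b
  assume "\<forall>x t a. (\<lambda>\<omega>. pmf (\<pi> x t \<omega>) a) \<in> borel_measurable (PiM {0..<t} (\<lambda>_. step_space))"
  then show "(\<lambda>\<omega>. pmf (if t = 0 then return_pmf a else \<pi> x t \<omega>) b)
      \<in> borel_measurable (PiM {0..<t} (\<lambda>_. step_space))"
    by (cases "t = 0") (simp_all del: split_paired_All)
qed

lemma (in cmdp) Ionescu_Tulcea_step_kernel:
  assumes \<pi>: "\<pi> \<in> hist_policies"
  shows "Ionescu_Tulcea (step_kernel p \<pi> x) (\<lambda>_. step_space)"
proof -
  have Pair_meas: "Pair a \<in> measurable (p s b) step_space" for s b and a :: 'a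
    unfolding step_space_def measurable_cong_sets[OF sets_kernel refl]
    by (rule measurable_Pair1') simp
  then have prob: "prob_space (distr (p s a) step_space (Pair a))" for s a
    using prob_space.prob_space_distr[OF prob_space_kernel] by blast
  have "step_kernel p \<pi> x t \<in> measurable (PiM {0..<t} (\<lambda>_. step_space)) (subprob_algebra step_space)"
    (is "_ \<in> measurable ?M _") for t
  proof -
    have pol: "(\<lambda>\<omega>. measure_pmf (\<pi> x t \<omega>)) \<in> measurable ?M (subprob_algebra (count_space UNIV))"
    proof (rule measurable_subprob_algebra)
      fix A :: "'a set"
      have "emeasure (measure_pmf (\<pi> x t \<omega>)) A = ennreal (\<Sum>a\<in>A. pmf (\<pi> x t \<omega>) a)" for \<omega>
        by (simp add: measure_pmf.emeasure_eq_measure measure_measure_pmf_finite)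
      moreover have "(\<lambda>\<omega>. \<Sum>a\<in>A. pmf (\<pi> x t \<omega>) a) \<in> borel_measurable ?M"
        using \<pi> unfolding hist_policies_def by (intro borel_measurable_sum) blast
      ultimately show "(\<lambda>\<omega>. emeasure (measure_pmf (\<pi> x t \<omega>)) A) \<in> borel_measurable ?M"
        by simp
    qed (auto intro: measure_pmf.subprob_space_axioms)
    have 1: "(\<lambda>(s, a). distr (p s a) step_space (Pair a))
        \<in> measurable (count_space UNIV \<Otimes>\<^sub>M count_space UNIV) (subprob_algebra step_space)"
      by (auto simp: pair_measure_countable space_subprob_algebra prob prob_space_imp_subprob_space)
    have 2: "(\<lambda>y. (state x (fst y) t, snd y))
        \<in> measurable (?M \<Otimes>\<^sub>M count_space UNIV) (count_space UNIV \<Otimes>\<^sub>M count_space UNIV)"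
      by (intro measurable_Pair measurable_compose[OF measurable_fst measurable_state]
          measurable_snd) simp
    have ker: "(\<lambda>y. distr (p (state x (fst y) t) (snd y)) step_space (Pair (snd y)))
        \<in> measurable (?M \<Otimes>\<^sub>M count_space UNIV) (subprob_algebra step_space)"
      using measurable_compose[OF 2 1] by (simp only: prod.case)
    show ?thesis
      unfolding step_kernel_def[abs_def] by (rule measurable_bind[OF pol ker])
  qed
  moreover have "prob_space (step_kernel p \<pi> x t \<omega>)" for t \<omega>
  proof -
    have "(\<lambda>a. distr (p (state x \<omega> t) a) step_space (Pair a))
        \<in> measurable (measure_pmf (\<pi> x t \<omega>)) (subprob_algebra step_space)"
      by (auto simp: prob prob_space_imp_subprob_space space_subprob_algebra)
    then show ?thesis
      unfolding step_kernel_def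
      using prob by (intro measure_pmf.prob_space_bind) auto
  qed
  ultimately show ?thesis
    by (intro Ionescu_Tulcea.intro)
qed

end

theory Submission
  imports Defs
begin

text \<open>
  Almost-sure statements about the augmented state at a fixed time depend only on which augmented
  states can be reached with positive probability, so everything reduces to reachability in the
  support graph.  If a feasible policy plays \<open>a\<close> in a reachable \<open>(s, k)\<close>, its own continuation
  witnesses \<open>k\<^sub>*(s, a) \<le> k\<close>.  Conversely \<open>k\<^sub>*(s, a) \<le> k\<close> gives some policy, possibly another one
  with a budget \<open>n \<le> k\<close>, that is safe after \<open>(s, n, a)\<close>; the first step does not depend on that
  policy, so its damage is at most \<open>k\<close>, and the budget remains nonnegative by induction.
\<close>

section \<open>The support graph of the kernel\<close>

definition possible :: "('s, 'a) kernel \<Rightarrow> 's \<Rightarrow> 'a \<Rightarrow> 's \<Rightarrow> bool \<Rightarrow> bool" where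
  "possible p s a s' d \<longleftrightarrow> \<not> (AE y in p s a. (fst y, snd (snd y)) \<noteq> (s', d))"

text \<open>The policy \<open>g\<close> may depend on time so that one graph serves both a
  stationary policy and one whose first action is forced. Budgets are integers, so a violation shows
  up as a reachable negative budget.\<close>

primrec reach ::
  "('s, 'a) kernel \<Rightarrow> (nat \<Rightarrow> ('s, 'a) stat_policy) \<Rightarrow> 's aug \<Rightarrow> nat \<Rightarrow> 's aug set" where
  "reach p g x 0 = {x}"
| "reach p g x (Suc t) =
    {(s', k - of_bool d) |s k a s' d.
      (s, k) \<in> reach p g x t \<and> a \<in> set_pmf (g t s k) \<and> possible p s a s' d}"

text \<open>The pair \<open>(s', d)\<close> has finitely many values, so the almost sure statement
  splits into one per value \<open>v\<close>; where \<open>Q\<close> fails, it says exactly that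
  \<open>v\<close> is not \<open>possible\<close>.\<close>

lemma AE_kernel_iff:
  fixes p :: "('s::finite, 'a) kernel"
  shows "(AE y in p s a. Q (fst y) (snd (snd y))) \<longleftrightarrow> (\<forall>s' d. possible p s a s' d \<longrightarrow> Q s' d)"
proof -
  have "(AE y in p s a. Q (fst y) (snd (snd y))) \<longleftrightarrow>
      (AE y in p s a. \<forall>v. (fst y, snd (snd y)) = v \<longrightarrow> Q (fst v) (snd v))"
    by simp
  also have "\<dots> \<longleftrightarrow> (\<forall>v. AE y in p s a. (fst y, snd (snd y)) = v \<longrightarrow> Q (fst v) (snd v))"
    by (rule AE_all_countable)
  also have "\<dots> \<longleftrightarrow> (\<forall>v. possible p s a (fst v) (snd v) \<longrightarrow> Q (fst v) (snd v))"
  proof (rule arg_cong[where f = All], rule ext)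
    fix v
    show "(AE y in p s a. (fst y, snd (snd y)) = v \<longrightarrow> Q (fst v) (snd v)) \<longleftrightarrow>
        (possible p s a (fst v) (snd v) \<longrightarrow> Q (fst v) (snd v))"
      by (cases "Q (fst v) (snd v)") (simp_all only: possible_def prod.collapse simp_thms AE_I2)
  qed
  finally show ?thesis by simp
qed

section \<open>The augmented state as a function of finitely many steps\<close>

lemma state_restrict [simp]: "state x (restrict \<omega> {0..<t}) t = state x \<omega> t"
  by (cases t) auto

lemma budget_restrict: "u \<le> t \<Longrightarrow> budget x (restrict \<omega> {0..<t}) u = budget x \<omega> u"
  by (induction u) (auto simp: damage_def)

lemma budget_fun_upd: "u \<le> t \<Longrightarrow> budget x (fun_upd \<omega> t y) u = budget x \<omega> u"
  by (induction u) (auto simp: damage_def)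

lemma budget_eq_sum: "budget x \<omega> t = snd x - int (\<Sum>i<t. damage \<omega> i)"
  by (induction t) auto

text \<open>Finitely many states and integer budgets form a countable space with discrete product
  sigma-algebra, hence \<open>P\<close> may be arbitrary.\<close>

lemma pred_aug_state:
  fixes x :: "'s::finite aug"
  assumes "{0..<t} \<subseteq> I"
  shows "Measurable.pred (PiM I (\<lambda>_. step_space)) (\<lambda>\<omega>. P (state x \<omega> t, budget x \<omega> t))"
proof -
  have 1: "(\<lambda>\<omega>. (state x \<omega> t, budget x \<omega> t))
      \<in> measurable (PiM I (\<lambda>_. step_space)) (count_space UNIV \<Otimes>\<^sub>M count_space UNIV)"
    by (intro measurable_Pair measurable_state measurable_budget assms)
  show ?thesis
    by (rule measurable_compose[OF 1]) (simp add: pair_measure_countable)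
qed

lemma pred_step: "Measurable.pred step_space (\<lambda>y. Q (fst (snd y)) (snd (snd (snd y))))"
  for Q :: "'s::finite \<Rightarrow> bool \<Rightarrow> bool"
proof -
  have 1: "(\<lambda>y. (fst (snd y), snd (snd (snd y)))) \<in>
      measurable step_space (count_space UNIV \<Otimes>\<^sub>M count_space UNIV)"
    unfolding step_space_def outcome_space_def by measurable
  have 2: "(\<lambda>(s, d). Q s d) \<in> measurable (count_space UNIV \<Otimes>\<^sub>M count_space UNIV) (count_space UNIV)"
    by (simp add: pair_measure_countable)
  show ?thesis using measurable_compose[OF 1 2] by simp
qed

section \<open>The trajectory law and reachability\<close>

context cmdp
begin

lemma measurable_Pair_kernel [measurable]: "Pair a \<in> measurable (p s b) step_space" for a :: 'b
  unfolding step_space_def measurable_cong_sets[OF sets_kernel refl]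
  by (rule measurable_Pair1') simp

text \<open>The step kernel is a mixture over actions: a property holds almost surely iff it does in
  almost every component, and for a pmf that means for every action in the support.\<close>

lemma AE_step_kernel_iff:
  "(AE y in step_kernel p \<pi> x t \<omega>. Q (fst (snd y)) (snd (snd (snd y)))) \<longleftrightarrow>
    (\<forall>a\<in>set_pmf (\<pi> x t \<omega>). \<forall>s' d. possible p (state x \<omega> t) a s' d \<longrightarrow> Q s' d)"
proof -
  let ?D = "\<lambda>a. distr (p (state x \<omega> t) a) step_space (Pair a)"
  have "prob_space (?D a)" for a
    by (intro prob_space.prob_space_distr prob_space_kernel measurable_Pair_kernel)
  then have N: "?D \<in> measurable (measure_pmf (\<pi> x t \<omega>)) (subprob_algebra step_space)"
    by (auto simp: prob_space_imp_subprob_space space_subprob_algebra)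
  show ?thesis
    unfolding step_kernel_def
    by (subst AE_bind[OF N pred_step], subst AE_measure_pmf_iff,
        subst AE_distr_iff[OF measurable_Pair_kernel])
       (use pred_step[unfolded pred_def] in \<open>auto simp: AE_kernel_iff\<close>)
qed

text \<open>Assumption \<open>g\<close> makes the policy Markov for the start \<open>x\<close>. The
  finite-horizon laws are unrolled step by step; the result passes to the limit law because the
  augmented state at time \<open>t\<close> depends only on the first \<open>t\<close>
  coordinates.\<close>

lemma AE_traj_iff_reach:
  assumes \<pi>: "\<pi> \<in> hist_policies"
    and g: "\<And>t \<omega>. \<pi> x t \<omega> = g t (state x \<omega> t) (budget x \<omega> t)"
  shows "(AE \<omega> in traj p \<pi> x. P (state x \<omega> t, budget x \<omega> t)) \<longleftrightarrow> (\<forall>y\<in>reach p g x t. P y)"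
proof -
  interpret IT: Ionescu_Tulcea "step_kernel p \<pi> x" "\<lambda>_. step_space"
    by (rule Ionescu_Tulcea_step_kernel[OF \<pi>])
  \<comment> \<open>The product over no coordinates has a single point, the function that is
    \<open>undefined\<close> everywhere; the chain starts there.\<close>
  let ?u = "\<lambda>_. undefined" and ?\<sigma> = "\<lambda>t \<omega>. (state x \<omega> t, budget x \<omega> t)"
  have u: "?u \<in> space (PiM {0..<0::nat} (\<lambda>_. step_space))"
    by (simp add: space_PiM)
  have C: "(AE \<omega> in IT.C 0 t ?u. P (?\<sigma> t \<omega>)) \<longleftrightarrow> (\<forall>y\<in>reach p g x t. P y)" for P
  proof (induction t arbitrary: P)
    case 0
    have "prob_space (IT.C 0 0 ?u)" using u by (rule IT.prob_space_C)
    from prob_space.AE_const[OF this] show ?case by simp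
  next
    case (Suc t)
    note pred = pred_aug_state[OF order_refl, where x = x and t = "Suc t" and P = P]
    have sets: "sets (IT.C 0 t ?u) = sets (PiM {0..<t} (\<lambda>_. step_space))"
      using IT.sets_C[OF u] by simp
    have eP: "IT.eP t \<in> measurable (IT.C 0 t ?u)
        (subprob_algebra (PiM {0..<Suc t} (\<lambda>_. step_space)))"
      using IT.measurable_eP[of t] by (simp add: measurable_cong_sets[OF sets refl])
    have "(AE \<omega> in IT.C 0 (Suc t) ?u. P (?\<sigma> (Suc t) \<omega>)) \<longleftrightarrow>
        (AE \<omega> in IT.C 0 t ?u. AE \<omega>' in IT.eP t \<omega>. P (?\<sigma> (Suc t) \<omega>'))"
      unfolding IT.C.simps add_0 by (rule AE_bind[OF eP pred])
    also have "\<dots> \<longleftrightarrow> (AE \<omega> in IT.C 0 t ?u. \<forall>a\<in>set_pmf (\<pi> x t \<omega>). \<forall>s' d.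
        possible p (state x \<omega> t) a s' d \<longrightarrow> P (s', budget x \<omega> t - of_bool d))"
    proof (rule AE_cong)
      fix \<omega> assume "\<omega> \<in> space (IT.C 0 t ?u)"
      then have \<omega>: "\<omega> \<in> space (PiM {0..<t} (\<lambda>_. step_space))"
        using IT.space_C[OF u] by simp
      have upd: "fun_upd \<omega> t \<in> measurable (step_kernel p \<pi> x t \<omega>) (PiM {0..<Suc t} (\<lambda>_. step_space))"
        using \<omega> by (intro measurable_fun_upd[where J = "{0..<t}"])
          (auto simp: measurable_cong_sets[OF IT.sets_P[OF \<omega>] refl])
      have "(AE \<omega>' in IT.eP t \<omega>. P (?\<sigma> (Suc t) \<omega>')) \<longleftrightarrow>
          (AE y in step_kernel p \<pi> x t \<omega>. P (?\<sigma> (Suc t) (fun_upd \<omega> t y)))"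
        unfolding IT.eP_def using pred[unfolded pred_def] by (rule AE_distr_iff[OF upd])
      \<comment> \<open>The budget at time \<open>t\<close> does not read coordinate
        \<open>t\<close>; the new step enters only through the damage subtracted at
        \<open>Suc t\<close>.\<close>
      also have "\<dots> \<longleftrightarrow> (AE y in step_kernel p \<pi> x t \<omega>.
          P (fst (snd y), budget x \<omega> t - of_bool (snd (snd (snd y)))))"
        by (simp add: budget_fun_upd damage_def)
      finally show "(AE \<omega>' in IT.eP t \<omega>. P (?\<sigma> (Suc t) \<omega>')) \<longleftrightarrow>
          (\<forall>a\<in>set_pmf (\<pi> x t \<omega>). \<forall>s' d.
            possible p (state x \<omega> t) a s' d \<longrightarrow> P (s', budget x \<omega> t - of_bool d))"
        using AE_step_kernel_iff[where Q = "\<lambda>s d. P (s, budget x \<omega> t - of_bool d)"] by simp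
    qed
    \<comment> \<open>\<open>P\<close> is arbitrary in the induction because the hypothesis is
      applied here to the one-step condition.\<close>
    also have "\<dots> \<longleftrightarrow> (\<forall>(s, k)\<in>reach p g x t. \<forall>a\<in>set_pmf (g t s k). \<forall>s' d.
        possible p s a s' d \<longrightarrow> P (s', k - of_bool d))"
      using Suc.IH[of "\<lambda>(s, k). \<forall>a\<in>set_pmf (g t s k). \<forall>s' d.
        possible p s a s' d \<longrightarrow> P (s', k - of_bool d)"] by (simp add: g)
    also have "\<dots> \<longleftrightarrow> (\<forall>y\<in>reach p g x (Suc t). P y)"
      by fastforce
    finally show ?case .
  qed
  \<comment> \<open>\<open>CI J\<close> runs the chain to the least time covering \<open>J\<close>
    and restricts to \<open>J\<close>; for an initial segment the restriction changes
    nothing.\<close>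
  have "IT.up_to {0..<t} = t"
    by (metis IT.up_to IT.up_to_iff_Ico antisym finite_atLeastLessThan ivl_subset le_zero_eq nle_le order_refl)
  then have "IT.CI {0..<t} = IT.C 0 t ?u"
    unfolding IT.CI_def using IT.distr_C[OF order_refl u, of t] by simp
  then have distr: "distr (traj p \<pi> x) (PiM {0..<t} (\<lambda>_. step_space)) (\<lambda>\<omega>. restrict \<omega> {0..<t}) = IT.C 0 t ?u"
    unfolding traj_def using IT.distr_lim[of "{0..<t}"] by simp
  have restr: "(\<lambda>\<omega>. restrict \<omega> {0..<t}) \<in>
      measurable (traj p \<pi> x) (PiM {0..<t} (\<lambda>_. step_space))"
    unfolding traj_def measurable_cong_sets[OF IT.PF.sets_lim refl]
    by (rule measurable_restrict_subset) simp
  have "(AE \<omega> in traj p \<pi> x. P (?\<sigma> t \<omega>)) \<longleftrightarrow>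
      (AE \<omega> in traj p \<pi> x. P (?\<sigma> t (restrict \<omega> {0..<t})))"
    by (simp add: budget_restrict)
  also have "\<dots> \<longleftrightarrow> (AE \<omega> in IT.C 0 t ?u. P (?\<sigma> t \<omega>))"
    unfolding distr[symmetric]
    using pred_aug_state[OF order_refl, where x = x and t = t and P = P, unfolded pred_def]
    by (rule AE_distr_iff[OF restr, symmetric])
  finally show ?thesis using C by simp
qed

lemma sets_traj:
  assumes \<pi>: "\<pi> \<in> hist_policies"
  shows "sets (traj p \<pi> x) = sets (PiM UNIV (\<lambda>_. step_space))"
proof -
  interpret IT: Ionescu_Tulcea "step_kernel p \<pi> x" "\<lambda>_. step_space"
    by (rule Ionescu_Tulcea_step_kernel[OF \<pi>])
  show ?thesis unfolding traj_def by (rule IT.PF.sets_lim)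
qed

text \<open>Total mass is preserved by pushforward, and already the marginal on the empty set of
  coordinates has mass one.\<close>

lemma prob_space_traj:
  assumes \<pi>: "\<pi> \<in> hist_policies"
  shows "prob_space (traj p \<pi> x)"
proof -
  interpret IT: Ionescu_Tulcea "step_kernel p \<pi> x" "\<lambda>_. step_space"
    by (rule Ionescu_Tulcea_step_kernel[OF \<pi>])
  have "(\<lambda>\<omega>. restrict \<omega> {}) \<in> measurable (traj p \<pi> x) (PiM {} (\<lambda>_. step_space))"
    unfolding measurable_cong_sets[OF sets_traj[OF \<pi>] refl]
    by (rule measurable_restrict_subset) simp
  then show ?thesis
    by (rule prob_space_distrD)
       (use IT.PF.prob_space_P[of "{}"] IT.distr_lim[of "{}"] in \<open>simp add: traj_def\<close>)
qed

lemma pred_traj: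
  assumes "\<pi> \<in> hist_policies"
  shows "Measurable.pred (traj p \<pi> x) (\<lambda>\<omega>. P (state x' \<omega> t, budget x' \<omega> t))"
  using pred_aug_state[where I = UNIV] by (simp add: measurable_cong_sets[OF sets_traj[OF assms] refl])

section \<open>Visited states and feasibility as reachability\<close>

lemma visited_iff_reach:
  "(s, k) \<in> visited p s0 \<Delta> \<pi> \<longleftrightarrow> k \<le> \<Delta> \<and> (\<exists>t. (s, int k) \<in> reach p (\<lambda>_. \<pi>) (s0, int \<Delta>) t)"
proof -
  let ?x = "(s0, int \<Delta>)" and ?\<pi> = "stationary \<pi>"
  interpret prob_space "traj p ?\<pi> ?x" by (rule prob_space_traj[OF stationary_in_hist_policies])
  have "measure (traj p ?\<pi> ?x) {\<omega> \<in> space (traj p ?\<pi> ?x). state ?x \<omega> t = s \<and> budget ?x \<omega> t = int k} > 0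
      \<longleftrightarrow> (s, int k) \<in> reach p (\<lambda>_. \<pi>) ?x t" for t
  proof -
    let ?A = "{\<omega> \<in> space (traj p ?\<pi> ?x). state ?x \<omega> t = s \<and> budget ?x \<omega> t = int k}"
    have "?A \<in> events"
      using pred_traj[OF stationary_in_hist_policies, of "\<lambda>y. y = (s, int k)" ?x t \<pi> ?x]
      by (simp add: pred_def)
    \<comment> \<open>A visit has probability zero iff the state is avoided almost surely, which is
      a predicate on a fixed time.\<close>
    then have "prob ?A = 0 \<longleftrightarrow> (AE \<omega> in traj p ?\<pi> ?x. \<not> (state ?x \<omega> t = s \<and> budget ?x \<omega> t = int k))"
      by (rule prob_eq_0[THEN trans]) (rule AE_cong, simp)
    also have "\<dots> \<longleftrightarrow> (s, int k) \<notin> reach p (\<lambda>_. \<pi>) ?x t"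
      using AE_traj_iff_reach[OF stationary_in_hist_policies,
          where g = "\<lambda>_. \<pi>" and P = "\<lambda>y. y \<noteq> (s, int k)"]
      by (auto simp: stationary_def)
    finally show ?thesis by (simp add: zero_less_measure_iff)
  qed
  then show ?thesis by (auto simp: visited_def aug_states_def Let_def)
qed

lemma feasible_iff_reach:
  "\<pi> \<in> feasible_stationary p s0 \<Delta> \<longleftrightarrow>
    (\<forall>t. \<forall>y\<in>reach p (\<lambda>_. \<pi>) (s0, int \<Delta>) t. 0 \<le> snd y)"
proof -
  let ?x = "(s0, int \<Delta>)" and ?\<pi> = "stationary \<pi>"
  interpret prob_space "traj p ?\<pi> ?x" by (rule prob_space_traj[OF stationary_in_hist_policies])
  have "measure (traj p ?\<pi> ?x) {\<omega> \<in> space (traj p ?\<pi> ?x). aug_damage ?x \<omega> t = 0} = 1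
      \<longleftrightarrow> (\<forall>y\<in>reach p (\<lambda>_. \<pi>) ?x (Suc t). 0 \<le> snd y)" for t
  proof -
    have ad: "aug_damage ?x \<omega> t = 0 \<longleftrightarrow> 0 \<le> budget ?x \<omega> (Suc t)" for \<omega>
      by (auto simp: aug_damage_def)
    have "{\<omega> \<in> space (traj p ?\<pi> ?x). 0 \<le> budget ?x \<omega> (Suc t)} \<in> events"
      using pred_traj[OF stationary_in_hist_policies, of "\<lambda>y. 0 \<le> snd y" ?x "Suc t" \<pi> ?x]
      by (simp add: pred_def)
    from prob_Collect_eq_1[OF this] show ?thesis
      using AE_traj_iff_reach[OF stationary_in_hist_policies, of \<pi> ?x,
          where g = "\<lambda>_. \<pi>" and P = "\<lambda>y. 0 \<le> snd y" and t = "Suc t"]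
      unfolding ad by (simp add: stationary_def)
  qed
  \<comment> \<open>\<open>aug_damage\<close> at \<open>t\<close> tests the budget at
    \<open>Suc t\<close>; time 0 comes for free since the initial budget is nonnegative.\<close>
  moreover have "(\<forall>t. \<forall>y\<in>reach p (\<lambda>_. \<pi>) ?x (Suc t). 0 \<le> snd y) \<longleftrightarrow>
      (\<forall>t. \<forall>y\<in>reach p (\<lambda>_. \<pi>) ?x t. 0 \<le> snd y)"
    by (metis not0_implies_Suc of_nat_0_le_iff reach.simps(1) singletonD snd_conv)
  ultimately show ?thesis
    by (simp add: feasible_stationary_def feasible_def problem_A_def Let_def
        stationary_in_hist_policies del: reach.simps)
qed

end

section \<open>The barrier function as safety in the graph\<close>

lemma total_damage_le_iff: "total_damage \<omega> \<le> of_nat k \<longleftrightarrow> (\<forall>t. 0 \<le> budget (s, int k) \<omega> t)"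
proof -
  \<comment> \<open>A series in \<open>ennreal\<close> is the supremum of its partial sums, so the
    bound on all future damage is a bound at every finite time.\<close>
  have "total_damage \<omega> \<le> of_nat k \<longleftrightarrow> (\<forall>t. (\<Sum>i<t. of_nat (damage \<omega> i)) \<le> (of_nat k :: ennreal))"
    unfolding total_damage_def suminf_eq_SUP by (simp add: SUP_le_iff)
  also have "\<dots> \<longleftrightarrow> (\<forall>t. (\<Sum>i<t. damage \<omega> i) \<le> k)"
    by (simp flip: of_nat_sum)
  also have "\<dots> \<longleftrightarrow> (\<forall>t. 0 \<le> budget (s, int k) \<omega> t)"
    by (simp add: budget_eq_sum flip: of_nat_sum)
  finally show ?thesis .
qed

text \<open>This is \<open>first_action a (stationary \<pi>)\<close> as a function of time and
  augmented state, the form that \<open>reach\<close> takes.\<close>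

definition commit :: "'a \<Rightarrow> ('s, 'a) stat_policy \<Rightarrow> nat \<Rightarrow> ('s, 'a) stat_policy" where
  "commit a \<pi> t = (if t = 0 then \<lambda>_ _. return_pmf a else \<pi>)"

definition safe :: "('s, 'a) kernel \<Rightarrow> ('s, 'a) stat_policy \<Rightarrow> 's \<Rightarrow> nat \<Rightarrow> 'a \<Rightarrow> bool" where
  "safe p \<pi> s k a \<longleftrightarrow> (\<forall>t. \<forall>y\<in>reach p (commit a \<pi>) (s, int k) t. 0 \<le> snd y)"

text \<open>The negated integrand is infinite where the budget ever becomes negative and zero
  elsewhere, so its integral is infinity times the probability of that event. Countably many times
  allow the quantifier over \<open>t\<close> to leave the almost sure statement.\<close>

lemma (in cmdp) barrier_eq: "barrier p \<pi> s k a = (if safe p \<pi> s k a then 0 else - \<infinity>)"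
proof -
  let ?x = "(s, int k)" and ?\<pi> = "first_action a (stationary \<pi>)"
  let ?T = "traj p ?\<pi> ?x"
  have H: "?\<pi> \<in> hist_policies"
    by (intro first_action_in_hist_policies stationary_in_hist_policies)
  have pred: "Measurable.pred ?T (\<lambda>\<omega>. 0 \<le> budget ?x \<omega> t)" for t
    using pred_traj[OF H, of "\<lambda>y. 0 \<le> snd y" ?x t ?x] by simp
  let ?B = "{\<omega> \<in> space ?T. \<not> (\<forall>t. 0 \<le> budget ?x \<omega> t)}"
  have B: "?B \<in> sets ?T" using pred by measurable
  have "safe p \<pi> s k a \<longleftrightarrow> (\<forall>t. AE \<omega> in ?T. 0 \<le> budget ?x \<omega> t)"
    unfolding safe_def
    using AE_traj_iff_reach[OF H, where x = ?x and g = "commit a \<pi>" and P = "\<lambda>y. 0 \<le> snd y"]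
    by (simp add: first_action_def stationary_def commit_def)
  also have "\<dots> \<longleftrightarrow> emeasure ?T ?B = 0"
    using B by (subst AE_all_countable[symmetric], subst AE_iff_measurable[OF B refl]) simp
  finally have safe: "safe p \<pi> s k a \<longleftrightarrow> emeasure ?T ?B = 0" .
  have "(\<integral>\<^sup>+\<omega>. e2ennreal (- barrier_ind (total_damage \<omega> \<le> of_nat k)) \<partial>?T)
      = (\<integral>\<^sup>+\<omega>. \<infinity> * indicator ?B \<omega> \<partial>?T)"
    by (intro nn_integral_cong)
       (auto simp: total_damage_le_iff[where s = s] barrier_ind_def split: split_indicator)
  also have "\<dots> = \<infinity> * emeasure ?T ?B"
    using B by (rule nn_integral_cmult_indicator)
  finally show ?thesis
    using safe by (auto simp: barrier_def ennreal_top_mult zero_ennreal.rep_eq)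
qed

lemma (in cmdp) opt_barrier_eq_0_iff: "opt_barrier p s k a = 0 \<longleftrightarrow> (\<exists>\<pi>. safe p \<pi> s k a)"
proof
  assume "opt_barrier p s k a = 0"
  then have "\<not> (\<forall>\<pi>. barrier p \<pi> s k a = - \<infinity>)"
    unfolding opt_barrier_def by (intro notI) simp
  then show "\<exists>\<pi>. safe p \<pi> s k a" by (metis barrier_eq)
next
  assume "\<exists>\<pi>. safe p \<pi> s k a"
  then obtain \<pi> where "barrier p \<pi> s k a = 0" by (auto simp: barrier_eq)
  then have "0 \<le> opt_barrier p s k a" unfolding opt_barrier_def by (metis SUP_upper UNIV_I)
  moreover have "opt_barrier p s k a \<le> 0"
    unfolding opt_barrier_def by (intro SUP_least) (simp add: barrier_eq)
  ultimately show "opt_barrier p s k a = 0" by simp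
qed

text \<open>Allowing any \<open>n \<le> k\<close> avoids monotonicity of safety in the budget: a
  policy reads the budget, so a witness for \<open>n\<close> need not be one for
  \<open>k\<close>.\<close>

lemma (in cmdp) min_budget_le_iff: "min_budget p s a \<le> enat k \<longleftrightarrow> (\<exists>n\<le>k. \<exists>\<pi>. safe p \<pi> s n a)"
proof -
  let ?K = "{k. \<forall>n. k = enat n \<longrightarrow> opt_barrier p s n a = 0}"
  \<comment> \<open>Nonemptiness turns the infimum into an attained minimum.\<close>
  have "\<infinity> \<in> ?K" by simp
  then have "Inf ?K = (LEAST x. x \<in> ?K)" by (auto simp: Inf_enat_def)
  then have Inf: "Inf ?K \<in> ?K" using LeastI[of "\<lambda>x. x \<in> ?K" \<infinity>] by simp
  have "Inf ?K \<le> enat k \<longleftrightarrow> (\<exists>n\<le>k. enat n \<in> ?K)"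
  proof
    assume le: "Inf ?K \<le> enat k"
    then obtain n where n: "Inf ?K = enat n" by (cases "Inf ?K") auto
    with le Inf show "\<exists>n\<le>k. enat n \<in> ?K" by (intro exI[of _ n]) auto
  next
    assume "\<exists>n\<le>k. enat n \<in> ?K"
    then obtain n where n: "n \<le> k" "enat n \<in> ?K" by blast
    from Inf_lower[OF n(2)] have "Inf ?K \<le> enat n" .
    also have "\<dots> \<le> enat k" using n(1) by simp
    finally show "Inf ?K \<le> enat k" .
  qed
  then show ?thesis by (simp add: min_budget_def opt_barrier_eq_0_iff)
qed

section \<open>The two inclusions\<close>

lemma reach_commit_subset:
  assumes "(s, k) \<in> reach p (\<lambda>_. \<pi>) x t" and "a \<in> set_pmf (\<pi> s k)"
  shows "reach p (commit a \<pi>) (s, k) u \<subseteq> reach p (\<lambda>_. \<pi>) x (t + u)"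
proof (induction u)
  case (Suc u)
  show ?case
  proof
    fix y assume "y \<in> reach p (commit a \<pi>) (s, k) (Suc u)"
    then obtain s1 k1 b s' d where y: "y = (s', k1 - of_bool d)"
      and 1: "(s1, k1) \<in> reach p (commit a \<pi>) (s, k) u"
      and b: "b \<in> set_pmf (commit a \<pi> u s1 k1)" and d: "possible p s1 b s' d"
      by auto
    \<comment> \<open>At \<open>u = 0\<close> only \<open>(s, k)\<close> is reachable, where
      \<open>\<pi>\<close> itself may play \<open>a\<close>; afterwards both follow
      \<open>\<pi>\<close>, and stationarity makes the time shift harmless.\<close>
    have "b \<in> set_pmf (\<pi> s1 k1)"
      using 1 b assms(2) by (cases u) (auto simp: commit_def)
    moreover have "(s1, k1) \<in> reach p (\<lambda>_. \<pi>) x (t + u)"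
      using 1 Suc.IH by blast
    ultimately show "y \<in> reach p (\<lambda>_. \<pi>) x (t + Suc u)"
      unfolding add_Suc_right reach.simps y using d by blast
  qed
qed (use assms in simp)

text \<open>Only the first step is inspected. Its action is \<open>a\<close> whatever
  \<open>\<pi>\<close> is, so the bound carries over to any other policy playing \<open>a\<close> in
  \<open>s\<close>.\<close>

lemma safe_damage_le:
  assumes "safe p \<pi> s n a" and "possible p s a s' d"
  shows "of_bool d \<le> int n"
proof -
  have "(s', int n - of_bool d) \<in> reach p (commit a \<pi>) (s, int n) (Suc 0)"
    using assms(2) by (auto simp: commit_def)
  then show ?thesis using assms(1) unfolding safe_def by fastforce
qed

lemma (in cmdp) feasible_imp_respects_budget:
  assumes "\<pi> \<in> feasible_stationary p s0 \<Delta>"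
  shows "respects_budget p (visited p s0 \<Delta> \<pi>) \<pi>"
proof -
  have "min_budget p s a \<le> enat k"
    if v: "(s, k) \<in> visited p s0 \<Delta> \<pi>" and a: "a \<in> set_pmf (\<pi> s (int k))" for s k a
  proof -
    obtain t where "(s, int k) \<in> reach p (\<lambda>_. \<pi>) (s0, int \<Delta>) t"
      using v by (auto simp: visited_iff_reach)
    from reach_commit_subset[OF this a] assms have "safe p \<pi> s k a"
      unfolding safe_def feasible_iff_reach by blast
    then show ?thesis by (auto simp: min_budget_le_iff)
  qed
  then show ?thesis
    unfolding respects_budget_def by (fastforce simp: set_pmf_iff not_less[symmetric])
qed

text \<open>Budgets never increase; this supplies the cap \<open>\<Delta>\<close> built into
  \<open>visited\<close>.\<close>

lemma reach_budget_le: "(s, k) \<in> reach p g x t \<Longrightarrow> k \<le> snd x"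
  by (induction t arbitrary: s k) (fastforce simp: of_bool_def split: if_splits)+

lemma (in cmdp) respects_budget_imp_feasible:
  assumes resp: "respects_budget p (visited p s0 \<Delta> \<pi>) \<pi>"
  shows "\<pi> \<in> feasible_stationary p s0 \<Delta>"
proof -
  have "0 \<le> k" if "(s, k) \<in> reach p (\<lambda>_. \<pi>) (s0, int \<Delta>) t" for s k t
    using that
  proof (induction t arbitrary: s k)
    case (Suc t)
    then obtain s1 k1 a d where 1: "(s1, k1) \<in> reach p (\<lambda>_. \<pi>) (s0, int \<Delta>) t"
      and a: "a \<in> set_pmf (\<pi> s1 k1)" and d: "possible p s1 a s d" and k: "k = k1 - of_bool d"
      by auto
    \<comment> \<open>The condition on \<open>\<pi>\<close> speaks of natural budgets only; the
      induction hypothesis shows that \<open>k1\<close> is one.\<close>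
    define m where "m = nat k1"
    have m: "k1 = int m" using Suc.IH[OF 1] by (simp add: m_def)
    have "m \<le> \<Delta>" using reach_budget_le[OF 1] m by simp
    with 1 m have "(s1, m) \<in> visited p s0 \<Delta> \<pi>" by (auto simp: visited_iff_reach)
    with resp a m have "min_budget p s1 a \<le> enat m"
      unfolding respects_budget_def by (fastforce simp: set_pmf_iff not_less[symmetric])
    \<comment> \<open>Neither \<open>\<pi>'\<close> nor \<open>n\<close> need match
      \<open>\<pi>\<close> and \<open>m\<close>; the next damage is still at most \<open>n\<close>,
      hence at most \<open>m\<close>.\<close>
    then obtain n \<pi>' where "n \<le> m" and "safe p \<pi>' s1 n a"
      by (auto simp: min_budget_le_iff)
    with safe_damage_le[OF _ d] k m show ?case by fastforce
  qed simp
  then show ?thesis unfolding feasible_iff_reach by force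
qed

text \<open>Feasibility constrains a policy only where its own run arrives, hence equality over
  visited states. Imposing the condition on all augmented states is stronger and gives an
  inclusion.\<close>

theorem theorem9:
  fixes p :: "('s::finite, 'a::finite) kernel" and s0 :: 's and \<Delta> :: nat
  assumes "cmdp p"
  shows "feasible_stationary p s0 \<Delta> = {\<pi>. respects_budget p (visited p s0 \<Delta> \<pi>) \<pi>}
    \<and> {\<pi>. respects_budget p (aug_states \<Delta>) \<pi>} \<subseteq> feasible_stationary p s0 \<Delta>"
proof -
  interpret cmdp p by fact
  have "visited p s0 \<Delta> \<pi> \<subseteq> aug_states \<Delta>" for \<pi>
    by (auto simp: visited_def)
  then have "respects_budget p (visited p s0 \<Delta> \<pi>) \<pi>" if "respects_budget p (aug_states \<Delta>) \<pi>" for \<pi>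
    using that unfolding respects_budget_def by blast
  then show ?thesis
    using feasible_imp_respects_budget respects_budget_imp_feasible by blast
qed

end
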